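(* Let $k$ be a real constant and let $\mathcal{C}_k$ be the class of affine pairwise separable (elementwise monotone, not necessarily monotone) cost functions with maximum degree of asymmetry $k$. Let $z^{EQ}$ be a Wardrop equilibrium of a nonatomic mixed-autonomy congestion game whose cost function is drawn from $\mathcal{C}_k$. (a) If $z^{OPT}$ is a social optimum for this game and $k<4$, then $C(z^{EQ})\le \frac{4}{4-k}\,C(z^{OPT})$. (b) If $w^{OPT}$ is a social optimum for the same game with $1+\frac{k}{4}$ times as many players of each type, then $C(z^{EQ})\le C(w^{OPT})$.
   Context: A nonatomic mixed-autonomy congestion game consists of a finite directed multigraph with $n\ge 1$ edges (roads), $m$ origin-destination pairs, and for each pair $j$ a mass $\alpha_j\ge 0$ of regular vehicles and a mass $\beta_j\ge 0$ of smart vehicles to be routed from its origin to its destination (each user is infinitesimal). A routing is a vector $z=(x_1,y_1,\dots,x_n,y_n)^T\in\mathbb{R}_{\ge0}^{2n}$, where $x_i,y_i$ are the masses of regular and smart vehicles on road $i$. $\mathcal{X}$ denotes the set of feasible routings: those induced by splitting each mass $\alpha_j$, and each mass $\beta_j$, among directed paths from origin to destination of pair $j$. Cost functions: the delay on road $i$, experienced identically by both vehicle types, is $c_i(x_i,y_i)=b_i+k_ia_ix_i+a_iy_i$ with $a_i\ge0$, $b_i\ge0$, $k_i>0$. Equivalently $c(z)=Az+b$, where $A$ is block diagonal with $2\times2$ blocks $A_i=\begin{bmatrix}k_ia_i&a_i\\k_ia_i&a_i\end{bmatrix}$ and $b=(b_1,b_1,\dots,b_n,b_n)^T$. $\mathcal{C}_k$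 is the class of such cost functions for which $\max(k_i,1/k_i)\le k$ for all $i$; $k$ is called the maximum degree of asymmetry of the class. Elementwise monotone means $\frac{\partial c_j}{\partial v_i}(v)\ge0$ for all $i,j$ (automatic here); monotone would mean $\langle c(z)-c(v),z-v\rangle\ge0$ for all $z,v\in\mathbb{R}_{\ge0}^{2n}$, which is not assumed. Social cost: $C(z)=\langle c(z),z\rangle$. A social optimum is a feasible routing attaining $\inf_{z\in\mathcal{X}}C(z)$. A Wardrop equilibrium is a feasible routing in which, for each origin-destination pair and each vehicle type, all paths used by that type for that pair have equal delay (sum of delays of the roads on the path), and no unused path for that pair has smaller delay. "The same game with $p$ times as many players of each type" means the same network and cost function with all masses $\alpha_j,\beta_j$ replaced by $p\alpha_j,p\beta_j$. *)

theory Defs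
  imports Complex_Main "Graph_Theory.Arc_Walk"
begin

datatype vehicle = Regular | Smart

text \<open>A routing \<open>z\<close> has components \<open>x\<^sub>e = z e Regular\<close> and \<open>y\<^sub>e = z e Smart\<close>; it plays the role of
  the vector \<open>(x\<^sub>1, y\<^sub>1, \<dots>, x\<^sub>n, y\<^sub>n)\<close>. Only its values on the arcs of the network matter.\<close>

type_synonym 'e routing = "'e \<Rightarrow> vehicle \<Rightarrow> real"

text \<open>Origin-destination pairs are numbered \<open>0, \<dots>, pairs - 1\<close>. The masses of pair \<open>j\<close> are
  \<open>\<alpha>\<^sub>j = mass j Regular\<close> and \<open>\<beta>\<^sub>j = mass j Smart\<close>. As for \<open>c(z) = A z + b\<close>, the cost
  function is vector-valued: \<open>cost z e t\<close> is the delay of road \<open>e\<close> for vehicles of type \<open>t\<close>.\<close>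

record ('v, 'e) game =
  network :: "('v, 'e) pre_digraph"
  pairs :: nat
  origin :: "nat \<Rightarrow> 'v"
  destination :: "nat \<Rightarrow> 'v"
  mass :: "nat \<Rightarrow> vehicle \<Rightarrow> real"
  cost :: "'e routing \<Rightarrow> 'e routing"

definition mixed_autonomy_game :: "('v, 'e) game \<Rightarrow> bool" where
  "mixed_autonomy_game \<Gamma> \<longleftrightarrow>
     fin_digraph (network \<Gamma>) \<and> arcs (network \<Gamma>) \<noteq> {} \<and>
     (\<forall>j<pairs \<Gamma>. origin \<Gamma> j \<in> verts (network \<Gamma>) \<and> destination \<Gamma> j \<in> verts (network \<Gamma>) \<and>
        (\<forall>t. 0 \<le> mass \<Gamma> j t))"

definition paths :: "('v, 'e) game \<Rightarrow> nat \<Rightarrow> 'e list set" where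
  "paths \<Gamma> j = {p. pre_digraph.apath (network \<Gamma>) (origin \<Gamma> j) p (destination \<Gamma> j)}"

text \<open>\<open>f j t p\<close> is the mass of vehicles of type \<open>t\<close> of pair \<open>j\<close> sent along the path \<open>p\<close>.\<close>

definition feasible_flow :: "('v, 'e) game \<Rightarrow> (nat \<Rightarrow> vehicle \<Rightarrow> 'e list \<Rightarrow> real) \<Rightarrow> bool" where
  "feasible_flow \<Gamma> f \<longleftrightarrow>
     (\<forall>j<pairs \<Gamma>. \<forall>t. (\<forall>p\<in>paths \<Gamma> j. 0 \<le> f j t p) \<and> (\<Sum>p\<in>paths \<Gamma> j. f j t p) = mass \<Gamma> j t)"

definition induced_routing ::
  "('v, 'e) game \<Rightarrow> (nat \<Rightarrow> vehicle \<Rightarrow> 'e list \<Rightarrow> real) \<Rightarrow> 'e routing" where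
  "induced_routing \<Gamma> f = (\<lambda>e t. \<Sum>j<pairs \<Gamma>. \<Sum>p\<in>{p \<in> paths \<Gamma> j. e \<in> set p}. f j t p)"

definition feasible_routings :: "('v, 'e) game \<Rightarrow> 'e routing set" where
  "feasible_routings \<Gamma> = {induced_routing \<Gamma> f | f. feasible_flow \<Gamma> f}"

definition social_cost :: "('v, 'e) game \<Rightarrow> 'e routing \<Rightarrow> real" where
  "social_cost \<Gamma> z = (\<Sum>e\<in>arcs (network \<Gamma>). \<Sum>t\<in>{Regular, Smart}. cost \<Gamma> z e t * z e t)"

definition social_optimum :: "('v, 'e) game \<Rightarrow> 'e routing \<Rightarrow> bool" where
  "social_optimum \<Gamma> z \<longleftrightarrow>
     z \<in> feasible_routings \<Gamma> \<and> social_cost \<Gamma> z = (INF w\<in>feasible_routings \<Gamma>. social_cost \<Gamma> w)"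

definition path_delay :: "('v, 'e) game \<Rightarrow> 'e routing \<Rightarrow> vehicle \<Rightarrow> 'e list \<Rightarrow> real" where
  "path_delay \<Gamma> z t p = (\<Sum>e\<leftarrow>p. cost \<Gamma> z e t)"

text \<open>Which paths are used is a property of the path flow, not of the routing it induces; a
  routing is an equilibrium if some feasible path flow inducing it satisfies the conditions.\<close>

definition wardrop_equilibrium :: "('v, 'e) game \<Rightarrow> 'e routing \<Rightarrow> bool" where
  "wardrop_equilibrium \<Gamma> z \<longleftrightarrow>
     (\<exists>f. feasible_flow \<Gamma> f \<and> z = induced_routing \<Gamma> f \<and>
        (\<forall>j<pairs \<Gamma>. \<forall>t. \<forall>p\<in>paths \<Gamma> j. \<forall>q\<in>paths \<Gamma> j. 0 < f j t p \<longrightarrow>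
           (0 < f j t q \<longrightarrow> path_delay \<Gamma> z t p = path_delay \<Gamma> z t q) \<and>
           (f j t q = 0 \<longrightarrow> path_delay \<Gamma> z t p \<le> path_delay \<Gamma> z t q)))"

text \<open>The affine pairwise separable cost functions on the roads \<open>E\<close> with maximum degree of
  asymmetry \<open>k\<close>; both vehicle types experience the same delay.\<close>

definition affine_costs :: "real \<Rightarrow> 'e set \<Rightarrow> ('e routing \<Rightarrow> 'e routing) set" where
  "affine_costs k E = {c. \<exists>a b \<kappa>. \<forall>e\<in>E.
     0 \<le> a e \<and> 0 \<le> b e \<and> 0 < \<kappa> e \<and> max (\<kappa> e) (1 / \<kappa> e) \<le> k \<and>
     (\<forall>z t. c z e t = b e + \<kappa> e * a e * z e Regular + a e * z e Smart)}"

definition scale_players :: "real \<Rightarrow> ('v, 'e) game \<Rightarrow> ('v, 'e) game" where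
  "scale_players r \<Gamma> = \<Gamma>\<lparr>mass := \<lambda>j t. r * mass \<Gamma> j t\<rparr>"

end

theory Submission
  imports Defs
begin

text \<open>An equilibrium \<open>z\<close> minimises the linear functional \<open>\<langle>c(z), v\<rangle>\<close> over the feasible routings \<open>v\<close>, so
  \<open>C(z) \<le> \<langle>c(z), v\<rangle>\<close>. On each road, completing the square gives
  \<open>(c(z) - c(v)) \<cdot> (v\<^sub>x + v\<^sub>y) \<le> k/4 \<cdot> c(z) \<cdot> (z\<^sub>x + z\<^sub>y)\<close>, hence
  \<open>\<langle>c(z), v\<rangle> \<le> C(v) + k/4 \<cdot> C(z)\<close> for every nonnegative \<open>v\<close>. Part (a) is the case \<open>v = z\<^sup>O\<^sup>P\<^sup>T\<close>;
  for part (b) combine the second inequality at \<open>w\<^sup>O\<^sup>P\<^sup>T\<close> with the first at \<open>w\<^sup>O\<^sup>P\<^sup>T / (1 + k/4)\<close>,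
  which is feasible for the original game.\<close>

definition routing_inner :: "('v, 'e) game \<Rightarrow> 'e routing \<Rightarrow> 'e routing \<Rightarrow> real" where
  "routing_inner \<Gamma> u v = (\<Sum>e\<in>arcs (network \<Gamma>). \<Sum>t\<in>{Regular, Smart}. u e t * v e t)"

lemma social_cost_eq_routing_inner: "social_cost \<Gamma> z = routing_inner \<Gamma> (cost \<Gamma> z) z"
  by (simp add: social_cost_def routing_inner_def)

lemma finite_paths:
  assumes "mixed_autonomy_game \<Gamma>"
  shows "finite (paths \<Gamma> j)"
proof -
  interpret fin_digraph "network \<Gamma>"
    using assms by (simp add: mixed_autonomy_game_def)
  show ?thesis
    unfolding paths_def by (rule apaths_finite)
qed

lemma path_properties:
  assumes "mixed_autonomy_game \<Gamma>" and "p \<in> paths \<Gamma> j"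
  shows "distinct p" and "set p \<subseteq> arcs (network \<Gamma>)"
proof -
  interpret fin_digraph "network \<Gamma>"
    using assms(1) by (simp add: mixed_autonomy_game_def)
  have p: "apath (origin \<Gamma> j) p (destination \<Gamma> j)"
    using assms(2) by (simp add: paths_def)
  then show "distinct p"
    unfolding apath_def by (blast intro: distinct_verts_imp_distinct)
  show "set p \<subseteq> arcs (network \<Gamma>)"
    using p by (auto simp: apath_def awalk_def)
qed

text \<open>Exchanging the sums over roads and paths turns road delays into path delays, the
  quantities in the Wardrop conditions. \<open>z\<close> and \<open>f\<close> are independent, so a
  competing flow can be priced at equilibrium delays.\<close>

lemma routing_inner_induced:
  assumes G: "mixed_autonomy_game \<Gamma>"
  shows "routing_inner \<Gamma> (cost \<Gamma> z) (induced_routing \<Gamma> f) =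
    (\<Sum>j<pairs \<Gamma>. \<Sum>t\<in>{Regular, Smart}. \<Sum>p\<in>paths \<Gamma> j. f j t p * path_delay \<Gamma> z t p)"
proof -
  let ?E = "arcs (network \<Gamma>)" and ?T = "{Regular, Smart}"
  have fE: "finite ?E"
    using G by (simp add: mixed_autonomy_game_def fin_digraph.finite_arcs)
  \<comment> \<open>A path meets each road at most once, so the list sum is a set sum. Padding with
    zeros gives an index set independent of \<open>p\<close>, ready for swapping.\<close>
  have delay: "path_delay \<Gamma> z t p = (\<Sum>e\<in>?E. if e \<in> set p then cost \<Gamma> z e t else 0)"
    if "p \<in> paths \<Gamma> j" for j t p
  proof -
    have "?E \<inter> set p = set p"
      using path_properties(2)[OF G that] by blast
    then show ?thesis
      using path_properties(1)[OF G that] fE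
      by (simp add: path_delay_def sum_list_distinct_conv_sum_set flip: sum.inter_restrict)
  qed
  have ind: "induced_routing \<Gamma> f e t =
      (\<Sum>j<pairs \<Gamma>. \<Sum>p\<in>paths \<Gamma> j. if e \<in> set p then f j t p else 0)" for e t
    unfolding induced_routing_def
    by (intro sum.cong refl sum.inter_filter finite_paths[OF G])
  have "routing_inner \<Gamma> (cost \<Gamma> z) (induced_routing \<Gamma> f) =
      (\<Sum>e\<in>?E. \<Sum>t\<in>?T. \<Sum>j<pairs \<Gamma>. \<Sum>p\<in>paths \<Gamma> j.
         f j t p * (if e \<in> set p then cost \<Gamma> z e t else 0))"
    unfolding routing_inner_def ind sum_distrib_left by (intro sum.cong refl) simp
  also have "\<dots> = (\<Sum>t\<in>?T. \<Sum>j<pairs \<Gamma>. \<Sum>e\<in>?E. \<Sum>p\<in>paths \<Gamma> j.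
         f j t p * (if e \<in> set p then cost \<Gamma> z e t else 0))"
    by (subst sum.swap) (intro sum.cong refl sum.swap)
  also have "\<dots> = (\<Sum>t\<in>?T. \<Sum>j<pairs \<Gamma>. \<Sum>p\<in>paths \<Gamma> j. \<Sum>e\<in>?E.
         f j t p * (if e \<in> set p then cost \<Gamma> z e t else 0))"
    by (intro sum.cong refl sum.swap)
  also have "\<dots> = (\<Sum>t\<in>?T. \<Sum>j<pairs \<Gamma>. \<Sum>p\<in>paths \<Gamma> j. f j t p * path_delay \<Gamma> z t p)"
    by (intro sum.cong refl) (simp add: delay sum_distrib_left)
  also have "\<dots> = (\<Sum>j<pairs \<Gamma>. \<Sum>t\<in>?T. \<Sum>p\<in>paths \<Gamma> j. f j t p * path_delay \<Gamma> z t p)"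
    by (rule sum.swap)
  finally show ?thesis .
qed

text \<open>On the support of \<open>f\<close>, \<open>D\<close> takes its least value
  \<open>D r\<close>. Equal totals let \<open>f\<close> be exchanged for \<open>g\<close> at this
  constant price, which bounds \<open>D\<close> from below.\<close>

lemma weighted_sum_le_of_support_minimal:
  fixes f g D :: "'a \<Rightarrow> real"
  assumes P: "finite P"
    and f: "\<And>p. p \<in> P \<Longrightarrow> 0 \<le> f p" and g: "\<And>p. p \<in> P \<Longrightarrow> 0 \<le> g p"
    and eq: "sum f P = sum g P"
    and minimal: "\<And>p q. \<lbrakk>p \<in> P; q \<in> P; 0 < f p\<rbrakk> \<Longrightarrow> D p \<le> D q"
  shows "(\<Sum>p\<in>P. f p * D p) \<le> (\<Sum>p\<in>P. g p * D p)"
proof (cases "\<exists>p\<in>P. 0 < f p")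
  case True
  then obtain r where r: "r \<in> P" "0 < f r"
    by blast
  have "(\<Sum>p\<in>P. f p * D p) \<le> (\<Sum>p\<in>P. f p * D r)"
    by (intro sum_mono) (metis f less_eq_real_def minimal mult_left_mono mult_zero_left r(1))
  also have "\<dots> = (\<Sum>p\<in>P. g p * D r)"
    using eq by (simp flip: sum_distrib_right)
  also have "\<dots> \<le> (\<Sum>p\<in>P. g p * D p)"
    by (intro sum_mono mult_left_mono minimal r g)
  finally show ?thesis .
next
  \<comment> \<open>With no support there is no \<open>r\<close>, but the common total is then zero
    and \<open>g\<close> vanishes too.\<close>
  case False
  with f have f0: "\<forall>p\<in>P. f p = 0"
    by (meson linorder_not_less order_antisym)
  then have "sum g P = 0"
    using eq by simp
  with P g have "\<forall>p\<in>P. g p = 0"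
    by (simp add: sum_nonneg_eq_0_iff)
  with f0 show ?thesis
    by simp
qed

lemma wardrop_variational_inequality:
  assumes G: "mixed_autonomy_game \<Gamma>"
    and eq: "wardrop_equilibrium \<Gamma> z" and v: "v \<in> feasible_routings \<Gamma>"
  shows "social_cost \<Gamma> z \<le> routing_inner \<Gamma> (cost \<Gamma> z) v"
proof -
  obtain f where f: "feasible_flow \<Gamma> f" "z = induced_routing \<Gamma> f"
    and W: "\<And>j t p q. \<lbrakk>j < pairs \<Gamma>; p \<in> paths \<Gamma> j; q \<in> paths \<Gamma> j; 0 < f j t p\<rbrakk> \<Longrightarrow>
           (0 < f j t q \<longrightarrow> path_delay \<Gamma> z t p = path_delay \<Gamma> z t q) \<and>
           (f j t q = 0 \<longrightarrow> path_delay \<Gamma> z t p \<le> path_delay \<Gamma> z t q)"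
    using eq unfolding wardrop_equilibrium_def by blast
  obtain g where g: "feasible_flow \<Gamma> g" "v = induced_routing \<Gamma> g"
    using v unfolding feasible_routings_def by blast
  have "routing_inner \<Gamma> (cost \<Gamma> z) (induced_routing \<Gamma> f)
      \<le> routing_inner \<Gamma> (cost \<Gamma> z) (induced_routing \<Gamma> g)"
    unfolding routing_inner_induced[OF G]
  proof (rule sum_mono, rule sum_mono, rule weighted_sum_le_of_support_minimal)
    fix j t p q
    assume "j \<in> {..<pairs \<Gamma>}" "p \<in> paths \<Gamma> j" "q \<in> paths \<Gamma> j" "0 < f j t p"
    moreover from this have "0 < f j t q \<or> f j t q = 0"
      using f(1) unfolding feasible_flow_def by (force simp: less_eq_real_def)
    ultimately show "path_delay \<Gamma> z t p \<le> path_delay \<Gamma> z t q"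
      using W[of j p q t] by force
  qed (use f(1) g(1) in \<open>auto simp: feasible_flow_def finite_paths[OF G]\<close>)
  then show ?thesis
    using f(2) g(2) by (simp add: social_cost_eq_routing_inner)
qed

lemma feasible_routing_nonneg:
  assumes "v \<in> feasible_routings \<Gamma>"
  shows "0 \<le> v e t"
  using assms
  by (auto simp: feasible_routings_def feasible_flow_def induced_routing_def intro!: sum_nonneg)

text \<open>The induced routing is linear in the path flow, and scaling the masses leaves the paths
  unchanged.\<close>

lemma feasible_routings_scale_players:
  assumes "w \<in> feasible_routings (scale_players r \<Gamma>)" and "0 < r"
  shows "(\<lambda>e t. w e t / r) \<in> feasible_routings \<Gamma>"
proof -
  have paths: "paths (scale_players r \<Gamma>) = paths \<Gamma>"
    by (simp add: paths_def scale_players_def fun_eq_iff)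
  obtain g where g: "feasible_flow (scale_players r \<Gamma>) g"
    and w: "w = induced_routing (scale_players r \<Gamma>) g"
    using assms(1) unfolding feasible_routings_def by blast
  have "feasible_flow \<Gamma> (\<lambda>j t p. g j t p / r)"
    using g assms(2) unfolding feasible_flow_def paths
    by (auto simp: scale_players_def simp flip: sum_divide_distrib)
  moreover have "(\<lambda>e t. w e t / r) = induced_routing \<Gamma> (\<lambda>j t p. g j t p / r)"
    unfolding w induced_routing_def paths
    by (simp add: scale_players_def sum_divide_distrib)
  ultimately show ?thesis
    unfolding feasible_routings_def by blast
qed

text \<open>The difference of delays times \<open>s\<close> is at most
  \<open>a * (L * s - m * s\<^sup>2)\<close>, hence at most \<open>a * L\<^sup>2 / (4 * m)\<close>.
  One factor \<open>L\<close> is then traded for \<open>x + y\<close>, at the price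
  \<open>k * m\<close>.\<close>

lemma road_delay_bound:
  fixes a b \<kappa> k x y v w :: real
  assumes a: "0 \<le> a" and b: "0 \<le> b" and \<kappa>: "0 < \<kappa>" "max \<kappa> (1 / \<kappa>) \<le> k"
    and nonneg: "0 \<le> x" "0 \<le> y" "0 \<le> v" "0 \<le> w"
  shows "(b + \<kappa> * a * x + a * y) * (v + w) \<le>
    (b + \<kappa> * a * v + a * w) * (v + w) + k / 4 * ((b + \<kappa> * a * x + a * y) * (x + y))"
proof -
  define m L s where "m = min \<kappa> 1" and "L = \<kappa> * x + y" and "s = v + w"
  have m: "0 < m"
    using \<kappa> by (simp add: m_def)
  \<comment> \<open>The ratio of \<open>max \<kappa> 1\<close> to \<open>min \<kappa> 1\<close> is
    exactly \<open>max \<kappa> (1 / \<kappa>)\<close>.\<close>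
  have M: "max \<kappa> 1 \<le> k * m"
  proof (cases "\<kappa> \<le> 1")
    case True
    then show ?thesis
      using \<kappa> by (simp add: m_def field_simps)
  next
    case False
    then show ?thesis
      using \<kappa> by (simp add: m_def)
  qed
  have k: "0 < k"
    using \<kappa> by linarith
  have L0: "0 \<le> L" and s0: "0 \<le> s"
    using nonneg \<kappa> by (simp_all add: L_def s_def)
  have "L \<le> max \<kappa> 1 * (x + y)"
    using mult_right_mono[of \<kappa> "max \<kappa> 1" x] mult_right_mono[of 1 "max \<kappa> 1" y] nonneg
    by (simp add: L_def distrib_left)
  also have "\<dots> \<le> k * m * (x + y)"
    using M nonneg by (intro mult_right_mono) auto
  finally have L: "L \<le> k * m * (x + y)" .
  have "m * s \<le> \<kappa> * v + w"
    using mult_right_mono[of m \<kappa> v] mult_right_mono[of m 1 w] nonneg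
    by (simp add: m_def s_def distrib_left)
  then have "(L - (\<kappa> * v + w)) * s \<le> (L - m * s) * s"
    using s0 by (intro mult_right_mono) auto
  \<comment> \<open>The concave quadratic in \<open>s\<close> peaks at
    \<open>s = L / (2 * m)\<close>.\<close>
  also have "\<dots> \<le> L * L / (4 * m)"
    using m zero_le_power2[of "L - 2 * m * s"]
    by (simp add: field_simps power2_eq_square)
  also have "\<dots> \<le> L * (k * m * (x + y)) / (4 * m)"
    using L L0 m by (intro divide_right_mono mult_left_mono) auto
  also have "\<dots> = k / 4 * (L * (x + y))"
    using m by simp
  finally have "a * ((L - (\<kappa> * v + w)) * s) \<le> a * (k / 4 * (L * (x + y)))"
    using a by (rule mult_left_mono)
  \<comment> \<open>The terms \<open>b * (v + w)\<close> cancel; this is the intercept term left on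
    the right.\<close>
  moreover have "0 \<le> k / 4 * (b * (x + y))"
    using k b nonneg by simp
  ultimately show ?thesis
    by (simp add: L_def s_def algebra_simps)
qed

text \<open>Both types meet the same delay, so the road bound can be summed. Taking \<open>v\<close>
  merely nonnegative covers the optimum of the scaled game, which need not be feasible for
  \<open>\<Gamma>\<close>.\<close>

lemma routing_inner_cost_le:
  assumes c: "cost \<Gamma> \<in> affine_costs k (arcs (network \<Gamma>))"
    and z: "\<And>e t. 0 \<le> z e t" and v: "\<And>e t. 0 \<le> v e t"
  shows "routing_inner \<Gamma> (cost \<Gamma> z) v \<le> social_cost \<Gamma> v + k / 4 * social_cost \<Gamma> z"
proof -
  obtain a b \<kappa> where c: "\<forall>e\<in>arcs (network \<Gamma>).
     0 \<le> a e \<and> 0 \<le> b e \<and> 0 < \<kappa> e \<and> max (\<kappa> e) (1 / \<kappa> e) \<le> k \<and>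
     (\<forall>z t. cost \<Gamma> z e t = b e + \<kappa> e * a e * z e Regular + a e * z e Smart)"
    using c unfolding affine_costs_def by blast
  have "routing_inner \<Gamma> (cost \<Gamma> z) v \<le>
      (\<Sum>e\<in>arcs (network \<Gamma>). (\<Sum>t\<in>{Regular, Smart}. cost \<Gamma> v e t * v e t) +
        k / 4 * (\<Sum>t\<in>{Regular, Smart}. cost \<Gamma> z e t * z e t))"
    unfolding routing_inner_def
  proof (rule sum_mono)
    fix e
    assume "e \<in> arcs (network \<Gamma>)"
    with c have ce: "0 \<le> a e" "0 \<le> b e" "0 < \<kappa> e" "max (\<kappa> e) (1 / \<kappa> e) \<le> k"
      and delay: "\<And>z t. cost \<Gamma> z e t = b e + \<kappa> e * a e * z e Regular + a e * z e Smart"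
      by blast+
    show "(\<Sum>t\<in>{Regular, Smart}. cost \<Gamma> z e t * v e t) \<le>
        (\<Sum>t\<in>{Regular, Smart}. cost \<Gamma> v e t * v e t) +
        k / 4 * (\<Sum>t\<in>{Regular, Smart}. cost \<Gamma> z e t * z e t)"
      using road_delay_bound[OF ce z[of e Regular] z[of e Smart] v[of e Regular] v[of e Smart]]
      by (simp add: delay flip: distrib_left)
  qed
  also have "\<dots> = social_cost \<Gamma> v + k / 4 * social_cost \<Gamma> z"
    unfolding social_cost_def sum.distrib by (simp only: sum_distrib_left)
  finally show ?thesis .
qed

text \<open>A single road gives a positive lower bound for \<open>k\<close>; this makes the scaling
  factor \<open>1 + k / 4\<close> positive.\<close>

lemma affine_costs_asymmetry_pos:
  assumes "c \<in> affine_costs k E" and "E \<noteq> {}"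
  shows "0 < k"
proof -
  obtain e where "e \<in> E"
    using assms(2) by blast
  with assms(1) obtain \<kappa> :: real where "0 < \<kappa>" "max \<kappa> (1 / \<kappa>) \<le> k"
    unfolding affine_costs_def by blast
  then show ?thesis
    by simp
qed

theorem theorem2:
  fixes \<Gamma> :: "('v, 'e) game" and k :: real and zEQ :: "'e routing"
  assumes "mixed_autonomy_game \<Gamma>"
    and "cost \<Gamma> \<in> affine_costs k (arcs (network \<Gamma>))"
    and "wardrop_equilibrium \<Gamma> zEQ"
  shows "(\<forall>zOPT. social_optimum \<Gamma> zOPT \<and> k < 4 \<longrightarrow>
            social_cost \<Gamma> zEQ \<le> 4 / (4 - k) * social_cost \<Gamma> zOPT) \<and>
         (\<forall>wOPT. social_optimum (scale_players (1 + k / 4) \<Gamma>) wOPT \<longrightarrow>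
            social_cost \<Gamma> zEQ \<le> social_cost \<Gamma> wOPT)"
proof (intro conjI allI impI)
  have "zEQ \<in> feasible_routings \<Gamma>"
    using assms(3) by (auto simp: wardrop_equilibrium_def feasible_routings_def)
  then have z: "0 \<le> zEQ e t" for e t
    by (rule feasible_routing_nonneg)
  have k: "0 < k"
    using affine_costs_asymmetry_pos[OF assms(2)] assms(1) by (simp add: mixed_autonomy_game_def)
  have bound: "routing_inner \<Gamma> (cost \<Gamma> zEQ) v \<le> social_cost \<Gamma> v + k / 4 * social_cost \<Gamma> zEQ"
    if "v \<in> feasible_routings \<Gamma>'" for v and \<Gamma>' :: "('v, 'e) game"
    using assms(2) z feasible_routing_nonneg[OF that] by (rule routing_inner_cost_le)
  show "social_cost \<Gamma> zEQ \<le> 4 / (4 - k) * social_cost \<Gamma> zOPT"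
    if "social_optimum \<Gamma> zOPT \<and> k < 4" for zOPT
  proof -
    have v: "zOPT \<in> feasible_routings \<Gamma>" and k4: "k < 4"
      using that by (auto simp: social_optimum_def)
    have "social_cost \<Gamma> zEQ \<le> social_cost \<Gamma> zOPT + k / 4 * social_cost \<Gamma> zEQ"
      using wardrop_variational_inequality[OF assms(1,3) v] bound[OF v]
      by linarith
    \<comment> \<open>Collecting the equilibrium cost leaves the coefficient
      \<open>1 - k / 4\<close>, positive for \<open>k < 4\<close>.\<close>
    with k4 show ?thesis
      by (simp add: field_simps)
  qed
  show "social_cost \<Gamma> zEQ \<le> social_cost \<Gamma> wOPT"
    if "social_optimum (scale_players (1 + k / 4) \<Gamma>) wOPT" for wOPT
  proof -
    let ?r = "1 + k / 4"
    have r: "0 < ?r"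
      using k by simp
    have w: "wOPT \<in> feasible_routings (scale_players ?r \<Gamma>)"
      using that by (simp add: social_optimum_def)
    have "social_cost \<Gamma> zEQ \<le> routing_inner \<Gamma> (cost \<Gamma> zEQ) (\<lambda>e t. wOPT e t / ?r)"
      by (rule wardrop_variational_inequality[OF assms(1,3) feasible_routings_scale_players[OF w r]])
    also have "\<dots> = routing_inner \<Gamma> (cost \<Gamma> zEQ) wOPT / ?r"
      by (simp add: routing_inner_def sum_divide_distrib add_divide_distrib)
    finally have "?r * social_cost \<Gamma> zEQ \<le> routing_inner \<Gamma> (cost \<Gamma> zEQ) wOPT"
      using r by (simp add: pos_le_divide_eq mult.commute)
    also have "\<dots> \<le> social_cost \<Gamma> wOPT + k / 4 * social_cost \<Gamma> zEQ"
      by (rule bound[OF w])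
    \<comment> \<open>The excess \<open>k / 4\<close> in \<open>?r\<close> cancels the equilibrium
      term of \<open>bound\<close>, which explains the choice of factor.\<close>
    finally show ?thesis
      by (simp add: algebra_simps)
  qed
qed

end
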